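(* Let $n,m\ge 1$ be integers, let $b_{ij}>0$ ($i=1,\dots,n$; $j=1,\dots,m$), $r_i>0$ ($i=1,\dots,n$) and $c_j>0$ ($j=1,\dots,m$) be real numbers with $\sum_{i=1}^n r_i=\sum_{j=1}^m c_j$, and put $a_{ij}=\log b_{ij}$. Then a matrix $X=(x_{ij})\in\mathbb{R}^{n\times m}$ is a balanced solution of the linear MOMA maximization problem with coefficients $b_{ij}$, column sums $c_j$ and row sums $r_i$ if and only if $X$ is an optimal solution of the optimal transport problem $$\text{maximize } \sum_{i=1}^n\sum_{j=1}^m a_{ij}x_{ij}\quad\text{subject to}\quad \sum_{i=1}^n x_{ij}=c_j\ (j=1,\dots,m),\quad \sum_{j=1}^m x_{ij}=r_i\ (i=1,\dots,n),\quad x_{ij}\ge 0\ (\text{all } i,j).$$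
   Context: The linear MOMA (multi-objective matrix allocation) maximization problem with data $(b_{ij}),(c_j),(r_i)$ has decision variables $X=(x_{ij})\in\mathbb{R}^{n\times m}$, objectives $\Psi_i(X)=\sum_{j=1}^m b_{ij}x_{ij}$ for $i=1,\dots,n$, primary constraints $\sum_{i=1}^n x_{ij}=c_j$ for all $j$ and $x_{ij}\ge 0$ for all $i,j$, and secondary constraints $\sum_{j=1}^m x_{ij}=r_i$ for all $i$. A matrix $X$ is a balanced solution if: (i) $X$ is Pareto efficient with respect to the objectives and the primary constraints only, i.e. $X$ satisfies the primary constraints and there is no matrix $\tilde X$ satisfying the primary constraints with $\Psi_i(\tilde X)\ge\Psi_i(X)$ for all $i=1,\dots,n$ and $\Psi_i(\tilde X)>\Psi_i(X)$ for at least one $i$; and (ii) $X$ satisfies the secondary constraints. *)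

theory Defs
  imports "HOL-Analysis.Analysis"
begin

text \<open>
  An \<open>n \<times> m\<close> matrix is a term of type \<open>real ^ 'm ^ 'n\<close>, so that \<open>X $ i $ j\<close>
  is the entry in row \<open>i :: 'n\<close> and column \<open>j :: 'm\<close>.
\<close>

definition moma_objective :: "real ^ 'm ^ 'n \<Rightarrow> real ^ 'm ^ 'n \<Rightarrow> 'n \<Rightarrow> real" where
  "moma_objective b X i = (\<Sum>j\<in>UNIV. b $ i $ j * X $ i $ j)"

text \<open>The primary constraints comprise the column sums and nonnegativity.\<close>

definition primary_constraints :: "real ^ 'm \<Rightarrow> real ^ 'm ^ 'n \<Rightarrow> bool" where
  "primary_constraints c X \<longleftrightarrow>
     (\<forall>j. (\<Sum>i\<in>UNIV. X $ i $ j) = c $ j) \<and> (\<forall>i j. 0 \<le> X $ i $ j)"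

definition secondary_constraints :: "real ^ 'n \<Rightarrow> real ^ 'm ^ 'n \<Rightarrow> bool" where
  "secondary_constraints r X \<longleftrightarrow> (\<forall>i. (\<Sum>j\<in>UNIV. X $ i $ j) = r $ i)"

definition pareto_efficient :: "real ^ 'm ^ 'n \<Rightarrow> real ^ 'm \<Rightarrow> real ^ 'm ^ 'n \<Rightarrow> bool" where
  "pareto_efficient b c X \<longleftrightarrow>
     primary_constraints c X \<and>
     \<not> (\<exists>Y. primary_constraints c Y \<and>
            (\<forall>i. moma_objective b Y i \<ge> moma_objective b X i) \<and>
            (\<exists>i. moma_objective b Y i > moma_objective b X i))"

definition balanced_solution ::
    "real ^ 'm ^ 'n \<Rightarrow> real ^ 'm \<Rightarrow> real ^ 'n \<Rightarrow> real ^ 'm ^ 'n \<Rightarrow> bool" where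
  "balanced_solution b c r X \<longleftrightarrow> pareto_efficient b c X \<and> secondary_constraints r X"

definition transport_feasible :: "real ^ 'm \<Rightarrow> real ^ 'n \<Rightarrow> real ^ 'm ^ 'n \<Rightarrow> bool" where
  "transport_feasible c r X \<longleftrightarrow>
     (\<forall>j. (\<Sum>i\<in>UNIV. X $ i $ j) = c $ j) \<and>
     (\<forall>i. (\<Sum>j\<in>UNIV. X $ i $ j) = r $ i) \<and>
     (\<forall>i j. 0 \<le> X $ i $ j)"

definition transport_value :: "real ^ 'm ^ 'n \<Rightarrow> real ^ 'm ^ 'n \<Rightarrow> real" where
  "transport_value a X = (\<Sum>i\<in>UNIV. \<Sum>j\<in>UNIV. a $ i $ j * X $ i $ j)"

definition transport_optimal ::
    "real ^ 'm ^ 'n \<Rightarrow> real ^ 'm \<Rightarrow> real ^ 'n \<Rightarrow> real ^ 'm ^ 'n \<Rightarrow> bool" where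
  "transport_optimal a c r X \<longleftrightarrow>
     transport_feasible c r X \<and>
     (\<forall>Y. transport_feasible c r Y \<longrightarrow> transport_value a Y \<le> transport_value a X)"

end

theory Submission
  imports Defs
begin

text \<open>
  Both properties are equivalent to the existence of row potentials \<open>u\<close> such that, in every
  column \<open>j\<close>, the mass of \<open>X\<close> sits on rows maximizing \<open>u\<^sub>i + a\<^sub>i\<^sub>j\<close>; for Pareto efficiency
  the weights \<open>exp u\<^sub>i\<close> scalarize the objectives. Moving mass in column \<open>j\<close> from a row \<open>k\<close> with
  \<open>x\<^sub>k\<^sub>j > 0\<close> to a row \<open>l\<close> is an edge from \<open>k\<close> to \<open>l\<close> of cost \<open>a\<^sub>k\<^sub>j - a\<^sub>l\<^sub>j\<close>, and potentials exist
  as soon as no closed walk has negative cost. A closed walk of negative cost yields a feasible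
  perturbation of \<open>X\<close>: moving equal amounts along the walk preserves the row sums and increases the
  transport value, whereas choosing the amounts so that every intermediate row breaks even
  increases the objective of the base row and changes no other objective.
\<close>

section \<open>Walks and potentials in a weighted graph\<close>

inductive walk :: "('a \<Rightarrow> 'a \<Rightarrow> real \<Rightarrow> bool) \<Rightarrow> 'a \<Rightarrow> 'a \<Rightarrow> real \<Rightarrow> bool"
  for E where
  walk_refl: "walk E i i 0"
| walk_step: "walk E i k s \<Longrightarrow> E k l d \<Longrightarrow> walk E i l (s + d)"

text \<open>
  As every two vertices are joined by an edge, closing up a walk bounds its cost from below, so
  that infimal walk costs from a fixed vertex are finite without removing cycles.
\<close>

lemma potential_exists:
  fixes E :: "'a \<Rightarrow> 'a \<Rightarrow> real \<Rightarrow> bool"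
  assumes total: "\<And>k l. \<exists>d. E k l d"
    and nonneg: "\<And>k s. walk E k k s \<Longrightarrow> 0 \<le> s"
  shows "\<exists>u. \<forall>k l d. E k l d \<longrightarrow> u l \<le> u k + d"
proof -
  fix x :: 'a
  define u where "u k = Inf {s. walk E x k s}" for k
  have ne: "{s. walk E x k s} \<noteq> {}" for k
    using total walk_step[OF walk_refl] by fast
  have bdd: "bdd_below {s. walk E x k s}" for k
  proof -
    obtain d where d: "E k x d" using total by blast
    have "- d \<le> s" if "walk E x k s" for s
      using nonneg[OF walk_step[OF that d]] by linarith
    then show ?thesis by (auto simp: bdd_below_def)
  qed
  have "u l \<le> u k + d" if e: "E k l d" for k l d
  proof -
    have "u l - d \<le> s" if "walk E x k s" for s
      using cInf_lower[OF _ bdd, of "s + d" l] walk_step[OF that e] by (simp add: u_def)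
    then have "u l - d \<le> u k"
      unfolding u_def[of k] by (intro cInf_greatest[OF ne]) auto
    then show ?thesis by linarith
  qed
  then show ?thesis by blast
qed

section \<open>Elementary mass shifts and linearity\<close>

text \<open>Adding this matrix moves mass \<delta> from row \<open>k\<close> to row
  \<open>l\<close>. The difference of two indicators yields the zero matrix for
  \<open>k = l\<close>, so loops in a walk need no separate case.\<close>

definition shift :: "'m \<Rightarrow> 'n \<Rightarrow> 'n \<Rightarrow> real \<Rightarrow> real ^ 'm ^ 'n" where
  "shift j k l \<delta> = (\<chi> p q. if q = j
     then (if p = l then \<delta> else 0) - (if p = k then \<delta> else 0) else 0)"

lemma sum_column_shift: "(\<Sum>p\<in>UNIV. shift j k l \<delta> $ p $ q) = 0"
  by (cases "q = j") (simp_all add: shift_def sum_subtractf)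

lemma shift_neg: "\<delta> > 0 \<Longrightarrow> shift j k l \<delta> $ p $ q < 0 \<Longrightarrow> p = k \<and> q = j"
  by (auto simp: shift_def split: if_splits)

lemma moma_objective_shift:
  "moma_objective b (shift j k l \<delta>) p =
     (if p = l then b $ l $ j * \<delta> else 0) - (if p = k then b $ k $ j * \<delta> else 0)"
  by (simp add: moma_objective_def shift_def if_distrib[of "\<lambda>x. _ * x"] algebra_simps
      cong: if_cong)

lemma moma_objective_add:
  "moma_objective b (X + Y) i = moma_objective b X i + moma_objective b Y i"
  by (simp add: moma_objective_def algebra_simps sum.distrib)

lemma moma_objective_scaleR: "moma_objective b (t *\<^sub>R X) i = t * moma_objective b X i"
  by (simp add: moma_objective_def algebra_simps sum_distrib_left)

lemma moma_objective_zero: "moma_objective b 0 i = 0"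
  by (simp add: moma_objective_def)

lemma transport_value_eq: "transport_value a X = (\<Sum>i\<in>UNIV. moma_objective a X i)"
  by (simp add: transport_value_def moma_objective_def)

text \<open>Row sums are objectives with unit coefficients, so the rules for
  \<open>moma_objective\<close> also track row sums.\<close>

lemma secondary_constraints_eq:
  "secondary_constraints r X \<longleftrightarrow> (\<forall>i. moma_objective (\<chi> i j. 1) X i = r $ i)"
  by (simp add: secondary_constraints_def moma_objective_def)

lemma transport_feasible_iff:
  "transport_feasible c r X \<longleftrightarrow> primary_constraints c X \<and> secondary_constraints r X"
  by (auto simp: transport_feasible_def primary_constraints_def secondary_constraints_def)

section \<open>Feasible directions\<close>

text \<open>Only signs are constrained, not sizes: shifts can be accumulated freely and a small step
  length is chosen once at the end.\<close>

definition balanced_direction :: "real ^ 'm ^ 'n \<Rightarrow> real ^ 'm ^ 'n \<Rightarrow> bool" where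
  "balanced_direction X Z \<longleftrightarrow>
     (\<forall>j. (\<Sum>i\<in>UNIV. Z $ i $ j) = 0) \<and> (\<forall>i j. Z $ i $ j < 0 \<longrightarrow> 0 < X $ i $ j)"

lemma balanced_direction_zero: "balanced_direction X 0"
  by (simp add: balanced_direction_def)

lemma balanced_direction_add_shift:
  assumes Z: "balanced_direction X Z" and X: "0 < X $ k $ j" and "0 < \<delta>"
  shows "balanced_direction X (Z + shift j k l \<delta>)"
proof -
  have "0 < X $ p $ q" if "Z $ p $ q + shift j k l \<delta> $ p $ q < 0" for p q
  proof (cases "Z $ p $ q < 0")
    case True
    then show ?thesis using Z by (simp add: balanced_direction_def)
  next
    case False
    then have "shift j k l \<delta> $ p $ q < 0" using that by linarith
    then show ?thesis using shift_neg[OF \<open>0 < \<delta>\<close>] X by metis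
  qed
  then show ?thesis
    using Z by (simp add: balanced_direction_def sum.distrib sum_column_shift)
qed

text \<open>Each entry stays nonnegative for all small \<open>t > 0\<close>, by continuity where
  \<open>Z\<close> is negative; there are finitely many entries, so one \<open>t\<close> serves
  all.\<close>

lemma balanced_direction_feasible:
  fixes X Z :: "real ^ 'm ^ 'n"
  assumes X: "primary_constraints c X" and Z: "balanced_direction X Z"
  obtains t where "0 < t" "primary_constraints c (X + t *\<^sub>R Z)"
proof -
  have "\<forall>\<^sub>F t in at_right 0. 0 \<le> X $ i $ j + t * Z $ i $ j" for i j
  proof (cases "Z $ i $ j < 0")
    case True
    then have pos: "0 < X $ i $ j" using Z by (simp add: balanced_direction_def)
    have "((\<lambda>t. X $ i $ j + t * Z $ i $ j) \<longlongrightarrow> X $ i $ j + 0 * Z $ i $ j) (at_right 0)"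
      by (intro tendsto_intros)
    then have "\<forall>\<^sub>F t in at_right 0. 0 < X $ i $ j + t * Z $ i $ j"
      using order_tendstoD(1)[of _ "X $ i $ j" _ 0] pos by simp
    then show ?thesis by eventually_elim simp
  next
    case False
    then show ?thesis
      using X eventually_at_right_less[of "0::real"]
      by (auto simp: primary_constraints_def elim!: eventually_mono)
  qed
  then have "\<forall>\<^sub>F t in at_right 0. \<forall>i j. 0 \<le> X $ i $ j + t * Z $ i $ j"
    by (simp add: eventually_all_finite)
  then have "\<forall>\<^sub>F t in at_right 0. 0 < t \<and> (\<forall>i j. 0 \<le> X $ i $ j + t * Z $ i $ j)"
    using eventually_at_right_less[of "0::real"] by eventually_elim simp
  then obtain t where "0 < t" "\<forall>i j. 0 \<le> X $ i $ j + t * Z $ i $ j"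
    using eventually_happens'[OF trivial_limit_at_right_real] by blast
  then show ?thesis
    using that[of t] X Z
    by (simp add: primary_constraints_def balanced_direction_def sum.distrib
        flip: sum_distrib_left)
qed

section \<open>Sufficiency of potentials\<close>

definition column_maximal :: "real ^ 'm ^ 'n \<Rightarrow> ('n \<Rightarrow> 'm \<Rightarrow> real) \<Rightarrow> bool" where
  "column_maximal X p \<longleftrightarrow> (\<forall>k l j. 0 < X $ k $ j \<longrightarrow> p l j \<le> p k j)"

text \<open>In each column the total mass \<open>c $ j\<close> is fixed, so it earns at most
  \<open>c $ j\<close> times the largest price, and \<open>X\<close> attains this bound.\<close>

lemma column_maximal_sum_le:
  fixes X Y :: "real ^ 'm ^ 'n"
  assumes X: "primary_constraints c X" and Y: "primary_constraints c Y"
    and p: "column_maximal X p"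
  shows "(\<Sum>i\<in>UNIV. \<Sum>j\<in>UNIV. p i j * Y $ i $ j) \<le> (\<Sum>i\<in>UNIV. \<Sum>j\<in>UNIV. p i j * X $ i $ j)"
proof -
  have "(\<Sum>i\<in>UNIV. p i j * Y $ i $ j) \<le> (\<Sum>i\<in>UNIV. p i j * X $ i $ j)" for j
  proof -
    define M where "M = Max (range (\<lambda>i. p i j))"
    have le: "p i j \<le> M" for i by (simp add: M_def)
    have "M \<in> range (\<lambda>i. p i j)" unfolding M_def by (intro Max_in) auto
    then have eq: "p i j = M" if "0 < X $ i $ j" for i
      using p that le[of i] by (force simp: column_maximal_def intro: antisym)
    have "(\<Sum>i\<in>UNIV. p i j * Y $ i $ j) \<le> (\<Sum>i\<in>UNIV. M * Y $ i $ j)"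
      using Y le by (intro sum_mono mult_right_mono) (auto simp: primary_constraints_def)
    also have "\<dots> = (\<Sum>i\<in>UNIV. M * X $ i $ j)"
      using X Y by (simp add: primary_constraints_def flip: sum_distrib_left)
    also have "\<dots> = (\<Sum>i\<in>UNIV. p i j * X $ i $ j)"
    proof (rule sum.cong[OF refl])
      fix i
      have "X $ i $ j = 0 \<or> 0 < X $ i $ j"
        using X by (auto simp: primary_constraints_def order_le_less)
      then show "M * X $ i $ j = p i j * X $ i $ j" using eq by auto
    qed
    finally show ?thesis .
  qed
  then show ?thesis
    by (subst (1 2) sum.swap) (rule sum_mono)
qed

text \<open>The row sums are prescribed, so adding \<open>u i\<close> to the coefficients changes
  the value of every feasible matrix by the same constant.\<close>

lemma column_maximal_imp_transport_optimal:
  assumes X: "transport_feasible c r X" and p: "column_maximal X (\<lambda>i j. u i + a $ i $ j)"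
  shows "transport_optimal a c r X"
  unfolding transport_optimal_def
proof (intro conjI allI impI X)
  have split: "(\<Sum>i\<in>UNIV. \<Sum>j\<in>UNIV. (u i + a $ i $ j) * V $ i $ j) =
      (\<Sum>i\<in>UNIV. u i * r $ i) + transport_value a V" if "transport_feasible c r V" for V
    using that by (simp add: transport_feasible_def transport_value_def distrib_right sum.distrib
        flip: sum_distrib_left)
  fix Y assume "transport_feasible c r Y"
  then show "transport_value a Y \<le> transport_value a X"
    using column_maximal_sum_le[OF _ _ p, of c Y] X split[of Y] split[OF X]
    by (simp add: transport_feasible_iff)
qed

text \<open>With positive weights, a Pareto improvement would strictly increase the weighted sum
  that \<open>X\<close> maximizes.\<close>

lemma column_maximal_imp_pareto_efficient:
  assumes X: "primary_constraints c X" and w: "\<And>i. 0 < w i"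
    and p: "column_maximal X (\<lambda>i j. w i * b $ i $ j)"
  shows "pareto_efficient b c X"
  unfolding pareto_efficient_def
proof (intro conjI X notI)
  assume "\<exists>Y. primary_constraints c Y \<and>
            (\<forall>i. moma_objective b Y i \<ge> moma_objective b X i) \<and>
            (\<exists>i. moma_objective b Y i > moma_objective b X i)"
  then obtain Y k where Y: "primary_constraints c Y"
    and ge: "\<And>i. moma_objective b X i \<le> moma_objective b Y i"
    and gt: "moma_objective b X k < moma_objective b Y k" by blast
  have "(\<Sum>i\<in>UNIV. w i * moma_objective b X i) < (\<Sum>i\<in>UNIV. w i * moma_objective b Y i)"
    using ge gt w by (intro sum_strict_mono_ex1) (auto intro!: mult_left_mono less_imp_le)
  also have "\<dots> \<le> (\<Sum>i\<in>UNIV. w i * moma_objective b X i)"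
    using column_maximal_sum_le[OF X Y p]
    by (simp add: moma_objective_def sum_distrib_left mult.assoc)
  finally show False by simp
qed

section \<open>Perturbations along walks\<close>

text \<open>A relation rather than a cost function, since different columns may give parallel edges
  of different cost.\<close>

definition mass_edge :: "real ^ 'm ^ 'n \<Rightarrow> real ^ 'm ^ 'n \<Rightarrow> 'n \<Rightarrow> 'n \<Rightarrow> real \<Rightarrow> bool" where
  "mass_edge a X k l d \<longleftrightarrow> (\<exists>j. 0 < X $ k $ j \<and> d = a $ k $ j - a $ l $ j)"

text \<open>One unit is moved along every edge, so that row sums cancel except at the two
  ends.\<close>

lemma walk_transport_direction:
  assumes "walk (mass_edge a X) i k s"
  shows "\<exists>Z. balanced_direction X Z \<and> transport_value a Z = - s \<and>
    (\<forall>p. moma_objective (\<chi> i j. 1) Z p = (if p = k then 1 else 0) - (if p = i then 1 else 0))"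
  using assms
proof induction
  case (walk_refl i)
  show ?case
    by (rule exI[of _ 0])
      (simp add: balanced_direction_zero transport_value_eq moma_objective_zero)
next
  case (walk_step i k s l d)
  then obtain Z j where "balanced_direction X Z" "transport_value a Z = - s"
    "\<forall>p. moma_objective (\<chi> i j. 1) Z p = (if p = k then 1 else 0) - (if p = i then 1 else 0)"
    and "0 < X $ k $ j" "d = a $ k $ j - a $ l $ j"
    by (auto simp: mass_edge_def)
  then show ?case
    by (intro exI[of _ "Z + shift j k l 1"])
      (simp add: balanced_direction_add_shift transport_value_eq moma_objective_add
        moma_objective_shift sum.distrib sum_subtractf)
qed

lemma walk_objective_direction:
  fixes b X :: "real ^ 'm ^ 'n"
  assumes "walk (mass_edge (\<chi> i j. ln (b $ i $ j)) X) i k s" and b: "\<And>i j. 0 < b $ i $ j"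
  shows "\<exists>Z. balanced_direction X Z \<and>
    (\<forall>p. moma_objective b Z p = (if p = k then exp (- s) else 0) - (if p = i then 1 else 0))"
  using assms(1)
proof induction
  case (walk_refl i)
  show ?case
    by (rule exI[of _ 0]) (simp add: balanced_direction_zero moma_objective_zero)
next
  case (walk_step i k s l d)
  then obtain Z j where Z: "balanced_direction X Z"
    "\<forall>p. moma_objective b Z p = (if p = k then exp (- s) else 0) - (if p = i then 1 else 0)"
    and X: "0 < X $ k $ j" and d: "d = ln (b $ k $ j) - ln (b $ l $ j)"
    by (auto simp: mass_edge_def)
  \<comment> \<open>The walk so far credits row \<open>k\<close> with \<open>exp (- s)\<close>;
    removing this amount from column \<open>j\<close> spends exactly that credit, and row
    \<open>l\<close> receives it multiplied by \<open>exp (- d)\<close>.\<close>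
  define \<delta> where "\<delta> = exp (- s) / b $ k $ j"
  have "0 < \<delta>" and k: "b $ k $ j * \<delta> = exp (- s)"
    using b[of k j] by (simp_all add: \<delta>_def)
  have "exp (- d) = b $ l $ j / b $ k $ j"
    using b by (simp add: d exp_diff)
  then have l: "b $ l $ j * \<delta> = exp (- (s + d))"
    by (simp add: \<delta>_def exp_add[of "- s" "- d", simplified])
  show ?case
    using Z k l balanced_direction_add_shift[OF Z(1) X \<open>0 < \<delta>\<close>]
    by (intro exI[of _ "Z + shift j k l \<delta>"]) (simp add: moma_objective_add moma_objective_shift)
qed

lemma transport_optimal_walk_nonneg:
  assumes X: "transport_optimal a c r X" and walk: "walk (mass_edge a X) k k s"
  shows "0 \<le> s"
proof (rule ccontr)
  assume "\<not> 0 \<le> s"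
  from walk_transport_direction[OF walk] obtain Z where Z: "balanced_direction X Z"
    "transport_value a Z = - s" "\<And>p. moma_objective (\<chi> i j. 1) Z p = 0" by auto
  have feas: "primary_constraints c X" "secondary_constraints r X"
    using X by (auto simp: transport_optimal_def transport_feasible_iff)
  obtain t where t: "0 < t" "primary_constraints c (X + t *\<^sub>R Z)"
    using balanced_direction_feasible[OF feas(1) Z(1)] .
  then have "transport_feasible c r (X + t *\<^sub>R Z)"
    using feas(2) Z(3) by (simp add: transport_feasible_iff secondary_constraints_eq
        moma_objective_add moma_objective_scaleR)
  then have "transport_value a (X + t *\<^sub>R Z) \<le> transport_value a X"
    using X by (simp add: transport_optimal_def)
  moreover have "transport_value a (X + t *\<^sub>R Z) = transport_value a X + t * (- s)"
    using Z(2) by (simp add: transport_value_eq moma_objective_add moma_objective_scaleR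
        sum.distrib flip: sum_distrib_left)
  moreover have "0 < t * (- s)" using \<open>\<not> 0 \<le> s\<close> t(1) by (intro mult_pos_pos) auto
  ultimately show False by linarith
qed

lemma pareto_efficient_walk_nonneg:
  fixes b X :: "real ^ 'm ^ 'n"
  assumes X: "pareto_efficient b c X" and b: "\<And>i j. 0 < b $ i $ j"
    and walk: "walk (mass_edge (\<chi> i j. ln (b $ i $ j)) X) k k s"
  shows "0 \<le> s"
proof (rule ccontr)
  assume "\<not> 0 \<le> s"
  from walk_objective_direction[OF walk b] obtain Z where Z: "balanced_direction X Z"
    "\<And>p. moma_objective b Z p = (if p = k then exp (- s) - 1 else 0)" by auto
  obtain t where t: "0 < t" "primary_constraints c (X + t *\<^sub>R Z)"
    using balanced_direction_feasible[OF _ Z(1)] X by (auto simp: pareto_efficient_def)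
  have "0 < t * (exp (- s) - 1)" using \<open>\<not> 0 \<le> s\<close> t(1) by simp
  then have "\<forall>i. moma_objective b (X + t *\<^sub>R Z) i \<ge> moma_objective b X i"
    "moma_objective b (X + t *\<^sub>R Z) k > moma_objective b X k"
    by (simp_all add: moma_objective_add moma_objective_scaleR Z(2))
  then show False using X t(2) unfolding pareto_efficient_def by blast
qed

text \<open>A positive row sum forces a positive entry in each row, hence an edge from each row to
  every other; the potential inequality along edges is column maximality.\<close>

lemma column_maximal_exists:
  assumes r: "\<And>i. 0 < r $ i" and X: "secondary_constraints r X"
    and nonneg: "\<And>k s. walk (mass_edge a X) k k s \<Longrightarrow> 0 \<le> s"
  obtains u where "column_maximal X (\<lambda>i j. u i + a $ i $ j)"
proof -
  have "\<exists>j. 0 < X $ k $ j" for k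
  proof (rule ccontr)
    assume "\<nexists>j. 0 < X $ k $ j"
    then have "(\<Sum>j\<in>UNIV. X $ k $ j) \<le> 0" by (intro sum_nonpos) (simp add: not_less)
    then show False using X r[of k] by (simp add: secondary_constraints_def)
  qed
  then have total: "\<exists>d. mass_edge a X k l d" for k l by (auto simp: mass_edge_def)
  obtain u where u: "\<And>k l d. mass_edge a X k l d \<Longrightarrow> u l \<le> u k + d"
    using potential_exists[of "mass_edge a X"] total nonneg by blast
  have "u l + a $ l $ j \<le> u k + a $ k $ j" if "0 < X $ k $ j" for k l j
    using u[of k l "a $ k $ j - a $ l $ j"] that by (fastforce simp: mass_edge_def)
  then show ?thesis using that[of u] by (simp add: column_maximal_def)
qed

theorem theorem3p3:
  fixes b X :: "real ^ 'm ^ 'n" and c :: "real ^ 'm" and r :: "real ^ 'n"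
  assumes "\<And>i j. b $ i $ j > 0"
    and "\<And>i. r $ i > 0"
    and "\<And>j. c $ j > 0"
    and "(\<Sum>i\<in>UNIV. r $ i) = (\<Sum>j\<in>UNIV. c $ j)"
  shows "balanced_solution b c r X \<longleftrightarrow> transport_optimal (\<chi> i j. ln (b $ i $ j)) c r X"
proof
  let ?a = "\<chi> i j. ln (b $ i $ j)"
  assume bal: "balanced_solution b c r X"
  then have X: "pareto_efficient b c X" "secondary_constraints r X"
    by (auto simp: balanced_solution_def)
  obtain u where "column_maximal X (\<lambda>i j. u i + ?a $ i $ j)"
    using column_maximal_exists[OF assms(2) X(2) pareto_efficient_walk_nonneg[OF X(1) assms(1)]] .
  then show "transport_optimal ?a c r X"
    using X by (intro column_maximal_imp_transport_optimal)
      (auto simp: transport_feasible_iff pareto_efficient_def)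
next
  let ?a = "\<chi> i j. ln (b $ i $ j)"
  assume opt: "transport_optimal ?a c r X"
  then have X: "primary_constraints c X" "secondary_constraints r X"
    by (auto simp: transport_optimal_def transport_feasible_iff)
  obtain u where u: "column_maximal X (\<lambda>i j. u i + ?a $ i $ j)"
    using column_maximal_exists[OF assms(2) X(2) transport_optimal_walk_nonneg[OF opt]] .
  \<comment> \<open>The exponential is increasing, so it turns additive potentials for
    \<open>ln b\<close> into positive scalarizing weights for \<open>b\<close> with the same
    maximizing rows.\<close>
  have "exp (u i + ?a $ i $ j) = exp (u i) * b $ i $ j" for i j
    using assms(1) by (simp add: exp_add)
  then have "column_maximal X (\<lambda>i j. exp (u i) * b $ i $ j)"
    using u unfolding column_maximal_def by (metis exp_le_cancel_iff)
  then show "balanced_solution b c r X"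
    using X column_maximal_imp_pareto_efficient[of c X "\<lambda>i. exp (u i)" b]
    by (simp add: balanced_solution_def)
qed

end
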